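(* For the battery charging game with $T>2$ time steps, the price of stability for ascending price profiles satisfies $\mathrm{PoS}_{\mathrm{ASC}}\ge\left\lfloor\frac{T}{2}\right\rfloor$.
   Context: **Battery charging game.** An instance consists of: a number of time steps $T\in\mathbb{N}$, with $[T]=\{1,\dots,T\}$; a finite directed graph $H=(V,E)$; for each $t\in[T]$ a copy $H_t=(V_t,E_t)$ of $H$ (the copy of $v\in V$ is $v_t$); a capacity $\kappa(e_t)\ge 0$ for each $e_t\in E_t$; a value $d(v_t)\in\mathbb{R}$ for each $v_t\in V_t$ (positive: supply, negative: demand); a finite set $B$ of battery agents, each $b\in B$ having a location $v^b\in V$, battery nodes $b_1,\dots,b_T$, and battery edges $(b_t,b_{t+1})$, $t\in[T-1]$, with capacities $\kappa((b_t,b_{t+1}))\ge 0$. For each $b,t$ there are two transaction edges $(b_t,v^b_t)$ and $(v^b_t,b_t)$ (with infinite capacity under $\kappa$). The graph $G$ is the union of all $H_t$, all battery nodes, battery edges and transaction edges. In addition there is a source $x$ with edges $(x,v_t)$ of capacity $\max(0,d(v_t))$ and a target $y$ with edges $(v_t,y)$ of capacity $\max(0,-d(v_t))$, for all $v_t\in V_t$, $t\in[T]$. **Strategies.** A strategy of agent $b$ is a vector $s_b=(s_{b,t})_{t\in[T]}\in\mathbb{R}^{[T]}$ (positive entries: charging, negative: discharging) with $0\le\sum_{z=1}^t s_{b,z}\le\kappa((b_t,b_{t+1}))$ for each $t\in[T-1]$. A strategy profile $\mathbf{s}$ consists of one strategy per agent. **Flow.** Given $\mathbf{s}$, $\kappa_{\mathbf{s}}$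 is defined by $\kappa_{\mathbf{s}}((v^b_t,b_t))=\max(0,s_{b,t})$, $\kappa_{\mathbf{s}}((b_t,v^b_t))=\max(0,-s_{b,t})$, and $\kappa_{\mathbf{s}}=\kappa$ on all other edges; $G_{\mathbf{s}}$ is the graph $G$ (with $x,y$) with capacities $\kappa_{\mathbf{s}}$. Flows are (real-valued) feasible $x$-$y$-flows, the value $|f|$ being the flow out of $x$; a maximum flow is one of maximum value. **Admissibility.** A transaction edge $e$ is admissible for $\mathbf{s}$ if every maximum flow $f$ in $G_{\mathbf{s}}$ saturates it, i.e. $f(e)=\kappa_{\mathbf{s}}(e)$. A strategy $s_b$ is admissible for $\mathbf{s}$ if all transaction edges of agent $b$ are admissible; $\mathbf{s}$ is admissible if all its strategies are. **Utilities.** For a price profile $\mathbf{p}=(p_t)_{t\in[T]}\in\mathbb{R}^{[T]}$, $u_b(\mathbf{s},\mathbf{p})=-\infty$ if $s_b$ is not admissible for $\mathbf{s}$, and $u_b(\mathbf{s},\mathbf{p})=-\sum_{t\in[T]}s_{b,t}p_t$ otherwise. **Nash equilibrium.** $\mathbf{s}$ is a (pure) Nash equilibrium for $\mathbf{p}$ if there is no agent $b$ with a strategy $s'_b$ such that $u_b((s'_b,\mathbf{s}_{-b}),\mathbf{p})>u_b(\mathbf{s},\mathbf{p})$. **Welfare and price of stability.** $W(\mathbf{s})$ is the value of a maximum flow in $G_{\mathbf{s}}$; $\mathrm{OPT}(G)$ is a strategy profile of maximum welfare (over all strategy profiles); $\mathrm{bestNE}(G,\mathbf{p})$ is a Nash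 equilibrium for $\mathbf{p}$ of maximum welfare (the ratio below is read as the infimum of the ratios over all Nash equilibria). For a class $P$ of price profiles (prices may depend on $G$), $$\mathrm{PoS}_P=\sup_G\ \inf_{\mathbf{p}\in P}\frac{W(\mathrm{OPT}(G))}{W(\mathrm{bestNE}(G,\mathbf{p}))},$$ with $G$ ranging over all instances with the given number $T$ of time steps. Conventions: $0/0=1$, $a/0=\infty$ for $a>0$; the infimum is over those $\mathbf{p}\in P$ admitting a Nash equilibrium and the supremum over those $G$ for which such $\mathbf{p}$ exists. **Price classes.** ASC: $p_1<p_2<\dots<p_T$. *)

theory Defs
  imports Complex_Main "HOL-Library.Extended_Real" "Graph_Theory.Pair_Digraph"
begin

section \<open>Flows in finite directed graphs\<close>

definition feasible_flow ::
  "('a, 'e) pre_digraph \<Rightarrow> ('e \<Rightarrow> real) \<Rightarrow> 'a \<Rightarrow> 'a \<Rightarrow> ('e \<Rightarrow> real) \<Rightarrow> bool" where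
  "feasible_flow G c x y f \<longleftrightarrow>
     (\<forall>e\<in>arcs G. 0 \<le> f e \<and> f e \<le> c e) \<and>
     (\<forall>v\<in>verts G - {x, y}. sum f (in_arcs G v) = sum f (out_arcs G v))"

definition flow_value :: "('a, 'e) pre_digraph \<Rightarrow> 'a \<Rightarrow> ('e \<Rightarrow> real) \<Rightarrow> real" where
  "flow_value G x f = sum f (out_arcs G x)"

definition max_flow ::
  "('a, 'e) pre_digraph \<Rightarrow> ('e \<Rightarrow> real) \<Rightarrow> 'a \<Rightarrow> 'a \<Rightarrow> ('e \<Rightarrow> real) \<Rightarrow> bool" where
  "max_flow G c x y = is_arg_max (flow_value G x) (feasible_flow G c x y)"

section \<open>Instances of the battery charging game\<close>

text \<open>
  Time steps are numbered from 1 to \<open>steps I\<close>. The value \<open>line_cap I t e\<close> is the capacity of the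
  time-\<open>t\<close> copy of the edge \<open>e\<close> of the underlying graph \<open>grid I\<close>, \<open>net_supply I t v\<close> is the (possibly
  negative) value \<open>d\<close> at the time-\<open>t\<close> copy of the vertex \<open>v\<close>, and \<open>battery_cap I b t\<close> is the
  capacity of the battery edge of agent \<open>b\<close> from time \<open>t\<close> to time \<open>t + 1\<close>.
\<close>

record ('v, 'b) battery_game =
  steps :: nat
  grid :: "'v pair_pre_digraph"
  line_cap :: "nat \<Rightarrow> 'v \<times> 'v \<Rightarrow> real"
  net_supply :: "nat \<Rightarrow> 'v \<Rightarrow> real"
  agents :: "'b set"
  location :: "'b \<Rightarrow> 'v"
  battery_cap :: "'b \<Rightarrow> nat \<Rightarrow> real"

definition valid_instance :: "('v, 'b) battery_game \<Rightarrow> bool" where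
  "valid_instance I \<longleftrightarrow>
     pair_fin_digraph (grid I) \<and>
     (\<forall>t\<in>{1..steps I}. \<forall>e\<in>parcs (grid I). 0 \<le> line_cap I t e) \<and>
     finite (agents I) \<and>
     (\<forall>b\<in>agents I. location I b \<in> pverts (grid I)) \<and>
     (\<forall>b\<in>agents I. \<forall>t\<in>{1..<steps I}. 0 \<le> battery_cap I b t)"

datatype ('v, 'b) node = Source | Target | Site 'v nat | Batt 'b nat

definition game_graph :: "('v, 'b) battery_game \<Rightarrow> ('v, 'b) node pair_pre_digraph" where
  "game_graph I =
     \<lparr> pverts = {Source, Target}
         \<union> {Site v t | v t. v \<in> pverts (grid I) \<and> t \<in> {1..steps I}}
         \<union> {Batt b t | b t. b \<in> agents I \<and> t \<in> {1..steps I}},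
       parcs = {(Site u t, Site v t) | u v t. (u, v) \<in> parcs (grid I) \<and> t \<in> {1..steps I}}
         \<union> {(Batt b t, Batt b (t + 1)) | b t. b \<in> agents I \<and> t \<in> {1..<steps I}}
         \<union> {(Site (location I b) t, Batt b t) | b t. b \<in> agents I \<and> t \<in> {1..steps I}}
         \<union> {(Batt b t, Site (location I b) t) | b t. b \<in> agents I \<and> t \<in> {1..steps I}}
         \<union> {(Source, Site v t) | v t. v \<in> pverts (grid I) \<and> t \<in> {1..steps I}}
         \<union> {(Site v t, Target) | v t. v \<in> pverts (grid I) \<and> t \<in> {1..steps I}} \<rparr>"

text \<open>
  A strategy profile \<open>s\<close> maps an agent and a time step to the amount charged. Values of \<open>s\<close> outside
  the set of agents or outside the time range are irrelevant everywhere below.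

  The following are the capacities under a profile \<open>s\<close>. The infinite capacities of the transaction
  edges never enter, because every profile overrides them. Pairs of nodes that are not arcs of
  \<open>game_graph I\<close> get an arbitrary value.
\<close>

fun capacity ::
  "('v, 'b) battery_game \<Rightarrow> ('b \<Rightarrow> nat \<Rightarrow> real) \<Rightarrow> ('v, 'b) node \<times> ('v, 'b) node \<Rightarrow> real" where
  "capacity I s (Site u t, Site v t') = line_cap I t (u, v)"
| "capacity I s (Batt b t, Batt b' t') = battery_cap I b t"
| "capacity I s (Site v t, Batt b t') = max 0 (s b t)"
| "capacity I s (Batt b t, Site v t') = max 0 (- s b t)"
| "capacity I s (Source, Site v t) = max 0 (net_supply I t v)"
| "capacity I s (Site v t, Target) = max 0 (- net_supply I t v)"
| "capacity I s _ = 0"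

section \<open>Strategies, utilities and equilibria\<close>

definition is_strategy :: "('v, 'b) battery_game \<Rightarrow> 'b \<Rightarrow> (nat \<Rightarrow> real) \<Rightarrow> bool" where
  "is_strategy I b \<sigma> \<longleftrightarrow>
     (\<forall>t\<in>{1..<steps I}. 0 \<le> (\<Sum>z=1..t. \<sigma> z) \<and> (\<Sum>z=1..t. \<sigma> z) \<le> battery_cap I b t)"

definition is_profile :: "('v, 'b) battery_game \<Rightarrow> ('b \<Rightarrow> nat \<Rightarrow> real) \<Rightarrow> bool" where
  "is_profile I s \<longleftrightarrow> (\<forall>b\<in>agents I. is_strategy I b (s b))"

definition admissible_edge ::
  "('v, 'b) battery_game \<Rightarrow> ('b \<Rightarrow> nat \<Rightarrow> real) \<Rightarrow> ('v, 'b) node \<times> ('v, 'b) node \<Rightarrow> bool" where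
  "admissible_edge I s e \<longleftrightarrow>
     (\<forall>f. max_flow (game_graph I) (capacity I s) Source Target f \<longrightarrow> f e = capacity I s e)"

definition admissible_strategy ::
  "('v, 'b) battery_game \<Rightarrow> ('b \<Rightarrow> nat \<Rightarrow> real) \<Rightarrow> 'b \<Rightarrow> bool" where
  "admissible_strategy I s b \<longleftrightarrow>
     (\<forall>t\<in>{1..steps I}.
        admissible_edge I s (Site (location I b) t, Batt b t) \<and>
        admissible_edge I s (Batt b t, Site (location I b) t))"

definition utility ::
  "('v, 'b) battery_game \<Rightarrow> ('b \<Rightarrow> nat \<Rightarrow> real) \<Rightarrow> (nat \<Rightarrow> real) \<Rightarrow> 'b \<Rightarrow> ereal" where
  "utility I s p b =
     (if admissible_strategy I s b then ereal (- (\<Sum>t=1..steps I. s b t * p t)) else - \<infinity>)"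

definition nash_equilibrium ::
  "('v, 'b) battery_game \<Rightarrow> (nat \<Rightarrow> real) \<Rightarrow> ('b \<Rightarrow> nat \<Rightarrow> real) \<Rightarrow> bool" where
  "nash_equilibrium I p s \<longleftrightarrow>
     is_profile I s \<and>
     \<not> (\<exists>b\<in>agents I. \<exists>\<sigma>. is_strategy I b \<sigma> \<and> utility I (s(b := \<sigma>)) p b > utility I s p b)"

section \<open>Welfare and price of stability\<close>

definition welfare :: "('v, 'b) battery_game \<Rightarrow> ('b \<Rightarrow> nat \<Rightarrow> real) \<Rightarrow> real" where
  "welfare I s = flow_value (game_graph I) Source
     (SOME f. max_flow (game_graph I) (capacity I s) Source Target f)"

definition OPT :: "('v, 'b) battery_game \<Rightarrow> 'b \<Rightarrow> nat \<Rightarrow> real" where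
  "OPT I = (ARG_MAX (welfare I) s. is_profile I s)"

text \<open>Ratios of nonnegative numbers with \<open>0/0 = 1\<close> and \<open>a/0 = \<infinity>\<close> for \<open>a > 0\<close>.\<close>

definition welfare_ratio :: "real \<Rightarrow> real \<Rightarrow> ereal" where
  "welfare_ratio a b = (if b = 0 then (if a = 0 then 1 else \<infinity>) else ereal (a / b))"

text \<open>
  The inner infimum ranges over all equilibria, which is the ratio for a best equilibrium whenever
  one exists. Every finite instance is isomorphic to one whose vertices and agents are natural
  numbers, so the supremum is taken over these.
\<close>

definition PoS :: "nat \<Rightarrow> (nat \<Rightarrow> real) set \<Rightarrow> ereal" where
  "PoS T P =
     (SUP I \<in> {I :: (nat, nat) battery_game. valid_instance I \<and> steps I = T \<and>
                 (\<exists>p\<in>P. \<exists>s. nash_equilibrium I p s)}.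
        INF p \<in> {p \<in> P. \<exists>s. nash_equilibrium I p s}.
          INF s \<in> {s. nash_equilibrium I p s}.
            welfare_ratio (welfare I (OPT I)) (welfare I s))"

definition ASC :: "nat \<Rightarrow> (nat \<Rightarrow> real) set" where
  "ASC T = {p. strict_mono_on {1..T} p}"

end

theory Submission
  imports Defs "HOL-Analysis.Function_Topology"
begin

text \<open>
  Take a single site with one agent. Up to time \<open>2n\<close>, where \<open>n\<close> is \<open>T div 2\<close>, unit supply and
  unit demand alternate, and the battery has capacity 1 before time \<open>2n\<close> and 0 afterwards. Charging
  at every odd and discharging at every even time yields welfare \<open>n\<close>. Summed by parts, however, the
  profit of an agent is a combination of its storage levels whose coefficients are the price
  increments. So under ascending prices the only best response keeps the battery full throughout: it
  charges at time 1 and discharges at time \<open>2n\<close>, which yields welfare 1.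

  Existence of maximum flows is essential: without it, every strategy would be vacuously admissible,
  and an agent could sell energy at time \<open>T\<close> that it never bought.
\<close>

section \<open>Existence of maximum flows\<close>

text \<open>Tychonoff's theorem, carried over from \<open>product_topology\<close> to the type-class
  topology on functions.\<close>

lemma compact_Pi_UNIV:
  fixes S :: "'i \<Rightarrow> 'a::topological_space set"
  assumes "\<And>i. compact (S i)"
  shows "compact {f. \<forall>i. f i \<in> S i}"
proof -
  have "compactin (product_topology (\<lambda>i. euclidean) UNIV) (Pi\<^sub>E UNIV S)"
    using assms by (simp add: compactin_PiE)
  moreover have "Pi\<^sub>E UNIV S = {f. \<forall>i. f i \<in> S i}"
    by auto
  ultimately show ?thesis
    by (simp add: euclidean_product_topology)
qed

lemma max_flow_exists:
  fixes G :: "('a, 'e) pre_digraph"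
  assumes fin: "finite (arcs G)" and nonneg: "\<And>e. e \<in> arcs G \<Longrightarrow> 0 \<le> c e"
  shows "\<exists>f. max_flow G c x y f"
proof -
  \<comment> \<open>\<open>feasible_flow\<close> leaves the values off the arcs free, which could
    destroy compactness; \<open>K\<close> pins them to 0.\<close>
  define K where "K = {f. \<forall>e. f e \<in> (if e \<in> arcs G then {0..c e} else {0})}"
  define C where "C = (\<Inter>v\<in>verts G - {x, y}.
    {f::'e \<Rightarrow> real. sum f (in_arcs G v) = sum f (out_arcs G v)})"
  have "compact K"
    unfolding K_def by (rule compact_Pi_UNIV) auto
  moreover have "closed C"
    unfolding C_def by (intro closed_INT ballI closed_Collect_eq continuous_on_sum) auto
  ultimately have "compact (K \<inter> C)"
    by blast
  moreover have "(\<lambda>e. 0) \<in> K \<inter> C"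
    using nonneg by (auto simp: K_def C_def)
  moreover have "continuous_on (K \<inter> C) (flow_value G x)"
    unfolding flow_value_def
    by (intro continuous_on_sum continuous_on_subset[OF continuous_on_product_coordinates]) auto
  ultimately obtain f where f: "f \<in> K \<inter> C"
    and max: "\<And>g. g \<in> K \<inter> C \<Longrightarrow> flow_value G x g \<le> flow_value G x f"
    using continuous_attains_sup[of "K \<inter> C"] by blast
  have "feasible_flow G c x y f"
    using f by (auto simp: feasible_flow_def K_def C_def split: if_splits)
  moreover have "flow_value G x g \<le> flow_value G x f" if g: "feasible_flow G c x y g" for g
  proof -
    \<comment> \<open>Cutting a feasible flow off outside the arcs puts it into the compact set
      without changing its value.\<close>
    define h where "h e = (if e \<in> arcs G then g e else 0)" for e
    have sum_h: "sum h (in_arcs G v) = sum g (in_arcs G v)"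
      "sum h (out_arcs G v) = sum g (out_arcs G v)" for v
      by (auto simp: h_def intro!: sum.cong)
    have "h \<in> K \<inter> C"
      using g unfolding K_def C_def feasible_flow_def by (auto simp: sum_h) (auto simp: h_def)
    then show ?thesis
      using max[of h] by (simp add: flow_value_def sum_h)
  qed
  ultimately show ?thesis
    by (auto simp: max_flow_def is_arg_max_linorder)
qed

section \<open>Games with one site and one agent\<close>

text \<open>Without grid arcs, energy moves between time steps only through the battery. Vertices
  and agents are natural numbers because \<open>PoS\<close> takes its supremum over such
  instances.\<close>

definition one_site_game :: "nat \<Rightarrow> (nat \<Rightarrow> real) \<Rightarrow> (nat \<Rightarrow> real) \<Rightarrow> (nat, nat) battery_game" where
  "one_site_game T d \<beta> =
     \<lparr> steps = T, grid = \<lparr> pverts = {0}, parcs = {} \<rparr>, line_cap = (\<lambda>t e. 0),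
       net_supply = (\<lambda>t v. d t), agents = {0}, location = (\<lambda>b. 0), battery_cap = (\<lambda>b. \<beta>) \<rparr>"

lemma one_site_game_simps [simp]:
  "steps (one_site_game T d \<beta>) = T"
  "grid (one_site_game T d \<beta>) = \<lparr> pverts = {0}, parcs = {} \<rparr>"
  "line_cap (one_site_game T d \<beta>) t e = 0"
  "net_supply (one_site_game T d \<beta>) t v = d t"
  "agents (one_site_game T d \<beta>) = {0}"
  "location (one_site_game T d \<beta>) b = 0"
  "battery_cap (one_site_game T d \<beta>) b t = \<beta> t"
  by (simp_all add: one_site_game_def)

abbreviation supply_arc :: "nat \<Rightarrow> (nat, nat) node \<times> (nat, nat) node" where
  "supply_arc t \<equiv> (Source, Site 0 t)"
abbreviation demand_arc :: "nat \<Rightarrow> (nat, nat) node \<times> (nat, nat) node" where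
  "demand_arc t \<equiv> (Site 0 t, Target)"
abbreviation charge_arc :: "nat \<Rightarrow> (nat, nat) node \<times> (nat, nat) node" where
  "charge_arc t \<equiv> (Site 0 t, Batt 0 t)"
abbreviation discharge_arc :: "nat \<Rightarrow> (nat, nat) node \<times> (nat, nat) node" where
  "discharge_arc t \<equiv> (Batt 0 t, Site 0 t)"
abbreviation storage_arc :: "nat \<Rightarrow> (nat, nat) node \<times> (nat, nat) node" where
  "storage_arc t \<equiv> (Batt 0 t, Batt 0 (t + 1))"

section \<open>Arcs, flow conservation and flow values with one site\<close>

lemma arcs_one_site_game:
  "arcs (game_graph (one_site_game T d \<beta>)) =
     supply_arc ` {1..T} \<union> demand_arc ` {1..T} \<union> charge_arc ` {1..T} \<union> discharge_arc ` {1..T}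
     \<union> storage_arc ` {1..<T}"
  by (auto simp: game_graph_def)

lemma verts_one_site_game:
  "verts (game_graph (one_site_game T d \<beta>)) =
     {Source, Target} \<union> Site 0 ` {1..T} \<union> Batt 0 ` {1..T}"
  by (auto simp: game_graph_def)

lemma incident_arcs_one_site_game:
  fixes T d \<beta>
  defines "G \<equiv> with_proj (game_graph (one_site_game T d \<beta>))"
  shows "out_arcs G Source = supply_arc ` {1..T}"
    and "t \<in> {1..T} \<Longrightarrow> in_arcs G (Site 0 t) = {supply_arc t, discharge_arc t}"
    and "t \<in> {1..T} \<Longrightarrow> out_arcs G (Site 0 t) = {demand_arc t, charge_arc t}"
    and "t \<in> {1..T} \<Longrightarrow> in_arcs G (Batt 0 t) =
           insert (charge_arc t) (if t = 1 then {} else {storage_arc (t - 1)})"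
    and "t \<in> {1..T} \<Longrightarrow> out_arcs G (Batt 0 t) =
           insert (discharge_arc t) (if t = T then {} else {storage_arc t})"
  unfolding G_def in_arcs_def out_arcs_def arcs_one_site_game
  by (auto simp: image_iff)

text \<open>Extending the storage by 0 to the times 0 and \<open>T\<close> gives battery
  conservation the same form at every time step, so that it telescopes.\<close>

definition stored :: "nat \<Rightarrow> ((nat, nat) node \<times> (nat, nat) node \<Rightarrow> real) \<Rightarrow> nat \<Rightarrow> real" where
  "stored T f t = (if t \<in> {1..<T} then f (storage_arc t) else 0)"

lemma feasible_flow_one_site_game:
  "feasible_flow (game_graph (one_site_game T d \<beta>)) (capacity (one_site_game T d \<beta>) s)
     Source Target f \<longleftrightarrow>
   (\<forall>t\<in>{1..T}.
      f (supply_arc t) \<in> {0..max 0 (d t)} \<and> f (demand_arc t) \<in> {0..max 0 (- d t)} \<and>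
      f (charge_arc t) \<in> {0..max 0 (s 0 t)} \<and> f (discharge_arc t) \<in> {0..max 0 (- s 0 t)} \<and>
      f (supply_arc t) + f (discharge_arc t) = f (demand_arc t) + f (charge_arc t) \<and>
      f (charge_arc t) + stored T f (t - 1) = f (discharge_arc t) + stored T f t) \<and>
   (\<forall>t\<in>{1..<T}. f (storage_arc t) \<in> {0..\<beta> t})"
proof -
  let ?G = "with_proj (game_graph (one_site_game T d \<beta>))"
  have site: "sum f (in_arcs ?G (Site 0 t)) = f (supply_arc t) + f (discharge_arc t)"
    "sum f (out_arcs ?G (Site 0 t)) = f (demand_arc t) + f (charge_arc t)"
    and batt: "sum f (in_arcs ?G (Batt 0 t)) = f (charge_arc t) + stored T f (t - 1)"
    "sum f (out_arcs ?G (Batt 0 t)) = f (discharge_arc t) + stored T f t"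
    if "t \<in> {1..T}" for t
    using that by (auto simp: incident_arcs_one_site_game stored_def)
  have cons: "(\<forall>v\<in>verts ?G - {Source, Target}. sum f (in_arcs ?G v) = sum f (out_arcs ?G v)) \<longleftrightarrow>
     (\<forall>t\<in>{1..T}. f (supply_arc t) + f (discharge_arc t) = f (demand_arc t) + f (charge_arc t) \<and>
      f (charge_arc t) + stored T f (t - 1) = f (discharge_arc t) + stored T f t)"
    unfolding verts_one_site_game using site batt by (auto simp: ball_Un)
  show ?thesis
    unfolding feasible_flow_def cons arcs_one_site_game by (auto simp: ball_Un)
qed

lemma flow_value_one_site_game:
  "flow_value (game_graph (one_site_game T d \<beta>)) Source f = (\<Sum>t=1..T. f (supply_arc t))"
  unfolding flow_value_def incident_arcs_one_site_game
  by (subst sum.reindex) (auto simp: inj_on_def)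

section \<open>Validity, welfare and the balance of the battery\<close>

lemma valid_one_site_game:
  assumes "\<forall>t. 0 \<le> \<beta> t"
  shows "valid_instance (one_site_game T d \<beta>)"
  unfolding valid_instance_def pair_fin_digraph_def pair_fin_digraph_axioms_def pair_wf_digraph_def
  using assms by auto

lemma max_flow_one_site_game_exists:
  assumes "\<forall>t. 0 \<le> \<beta> t"
  shows "\<exists>f. max_flow (game_graph (one_site_game T d \<beta>))
           (capacity (one_site_game T d \<beta>) s) Source Target f"
proof (rule max_flow_exists)
  show "finite (arcs (game_graph (one_site_game T d \<beta>)))"
    unfolding arcs_one_site_game by simp
  show "0 \<le> capacity (one_site_game T d \<beta>) s e"
    if "e \<in> arcs (game_graph (one_site_game T d \<beta>))" for e
    using that assms unfolding arcs_one_site_game by auto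
qed

text \<open>\<open>welfare\<close> evaluates an arbitrarily chosen maximum flow; all of them have
  the same value, so any one at hand will do.\<close>

lemma welfare_eq_flow_value:
  assumes "max_flow (game_graph I) (capacity I s) Source Target f"
  shows "welfare I s = flow_value (game_graph I) Source f"
proof -
  have "max_flow (game_graph I) (capacity I s) Source Target
    (SOME f. max_flow (game_graph I) (capacity I s) Source Target f)"
    by (rule someI[of _ f]) (rule assms)
  with assms show ?thesis
    unfolding welfare_def max_flow_def is_arg_max_linorder by (meson order_antisym)
qed

text \<open>The supply arcs form a cut around the source.\<close>

lemma welfare_le_total_supply:
  assumes "\<forall>t. 0 \<le> \<beta> t"
  shows "welfare (one_site_game T d \<beta>) s \<le> (\<Sum>t=1..T. max 0 (d t))"
proof -
  obtain f where f: "max_flow (game_graph (one_site_game T d \<beta>))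
      (capacity (one_site_game T d \<beta>) s) Source Target f"
    using max_flow_one_site_game_exists[OF assms] by blast
  then have "f (supply_arc t) \<le> max 0 (d t)" if "t \<in> {1..T}" for t
    using that unfolding max_flow_def is_arg_max_def feasible_flow_one_site_game by auto
  then show ?thesis
    using welfare_eq_flow_value[OF f] by (auto simp: flow_value_one_site_game intro!: sum_mono)
qed

text \<open>The battery starts and ends empty, so its net charging telescopes to 0.\<close>

lemma total_charge_eq_total_discharge:
  assumes "feasible_flow (game_graph (one_site_game T d \<beta>)) (capacity (one_site_game T d \<beta>) s)
     Source Target f"
  shows "(\<Sum>t=1..T. f (charge_arc t)) = (\<Sum>t=1..T. f (discharge_arc t))"
proof -
  have "f (charge_arc t) - f (discharge_arc t) = stored T f t - stored T f (t - 1)"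
    if "t \<in> {1..T}" for t
    using assms that unfolding feasible_flow_one_site_game by (auto simp: algebra_simps)
  then have "(\<Sum>t=1..T. f (charge_arc t)) - (\<Sum>t=1..T. f (discharge_arc t)) =
      (\<Sum>t=1..T. stored T f t - stored T f (t - 1))"
    by (simp flip: sum_subtractf)
  also have "\<dots> = stored T f T - stored T f 0"
    using sum_telescope''[of 0 T "stored T f"] by simp
  also have "\<dots> = 0"
    by (simp add: stored_def)
  finally show ?thesis by simp
qed

text \<open>\<open>is_strategy\<close> constrains only the partial sums before \<open>T\<close>, so
  the total is settled by the network: some maximum flow exists, admissibility makes it carry out
  every transaction, and the battery balances charging and discharging.\<close>

lemma admissible_imp_sum_eq_0:
  assumes "\<forall>t. 0 \<le> \<beta> t" and adm: "admissible_strategy (one_site_game T d \<beta>) s 0"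
  shows "(\<Sum>t=1..T. s 0 t) = 0"
proof -
  obtain f where f: "max_flow (game_graph (one_site_game T d \<beta>))
      (capacity (one_site_game T d \<beta>) s) Source Target f"
    using max_flow_one_site_game_exists[OF assms(1)] by blast
  then have "(\<Sum>t=1..T. f (charge_arc t)) = (\<Sum>t=1..T. f (discharge_arc t))"
    using total_charge_eq_total_discharge unfolding max_flow_def is_arg_max_def by blast
  moreover have "f (charge_arc t) = max 0 (s 0 t)" "f (discharge_arc t) = max 0 (- s 0 t)"
    if "t \<in> {1..T}" for t
    using adm f that by (auto simp: admissible_strategy_def admissible_edge_def)
  ultimately have "(\<Sum>t=1..T. max 0 (s 0 t) - max 0 (- s 0 t)) = 0"
    by (simp add: sum_subtractf)
  moreover have "max 0 x - max 0 (- x) = x" for x :: real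
    by auto
  ultimately show ?thesis by simp
qed

text \<open>A matched strategy is met by local supply or demand at every time, so its transactions are
  served by an explicit flow, which cannot be improved.\<close>

definition matched_strategy ::
  "nat \<Rightarrow> (nat \<Rightarrow> real) \<Rightarrow> (nat \<Rightarrow> real) \<Rightarrow> (nat \<Rightarrow> real) \<Rightarrow> bool" where
  "matched_strategy T d \<beta> \<sigma> \<longleftrightarrow>
     is_strategy (one_site_game T d \<beta>) 0 \<sigma> \<and>
     (\<forall>t\<in>{1..T}. max 0 (\<sigma> t) \<le> max 0 (d t) \<and> max 0 (- \<sigma> t) \<le> max 0 (- d t)) \<and>
     (\<Sum>t=1..T. \<sigma> t) = 0"

lemma matched_flow:
  assumes \<beta>: "\<forall>t. 0 \<le> \<beta> t" and matched: "matched_strategy T d \<beta> (s 0)"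
  shows "\<exists>f. feasible_flow (game_graph (one_site_game T d \<beta>))
      (capacity (one_site_game T d \<beta>) s) Source Target f \<and>
    flow_value (game_graph (one_site_game T d \<beta>)) Source f = (\<Sum>t=1..T. max 0 (s 0 t))"
proof -
  have strat: "is_strategy (one_site_game T d \<beta>) 0 (s 0)"
    and sup: "\<forall>t\<in>{1..T}. max 0 (s 0 t) \<le> max 0 (d t)"
    and dem: "\<forall>t\<in>{1..T}. max 0 (- s 0 t) \<le> max 0 (- d t)"
    and sum0: "(\<Sum>t=1..T. s 0 t) = 0"
    using matched by (auto simp: matched_strategy_def)
  \<comment> \<open>Energy is charged from the supply and discharged to the demand of the same time
    step; the battery arcs carry the running total.\<close>
  define f :: "(nat, nat) node \<times> (nat, nat) node \<Rightarrow> real" where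
    "f = (\<lambda>(u, v). case (u, v) of
        (Source, Site _ t) \<Rightarrow> max 0 (s 0 t) | (Site _ t, Batt _ _) \<Rightarrow> max 0 (s 0 t)
      | (Site _ t, Target) \<Rightarrow> max 0 (- s 0 t) | (Batt _ t, Site _ _) \<Rightarrow> max 0 (- s 0 t)
      | (Batt _ t, Batt _ _) \<Rightarrow> (\<Sum>z=1..t. s 0 z) | _ \<Rightarrow> 0)"
  have f_simps: "f (supply_arc t) = max 0 (s 0 t)" "f (demand_arc t) = max 0 (- s 0 t)"
    "f (charge_arc t) = max 0 (s 0 t)" "f (discharge_arc t) = max 0 (- s 0 t)"
    "f (storage_arc t) = (\<Sum>z=1..t. s 0 z)" for t
    by (simp_all add: f_def)
  \<comment> \<open>At \<open>t = T\<close> the convention in \<open>stored\<close> gives 0, which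
    agrees with the partial sum because the strategy sums to 0.\<close>
  have stored: "stored T f t = (\<Sum>z=1..t. s 0 z)" if "t \<le> T" for t
    using that sum0 f_simps(5)[of t]
    by (cases "t = T") (auto simp: stored_def)
  have "max 0 (s 0 t) + stored T f (t - 1) = max 0 (- s 0 t) + stored T f t"
    if t: "t \<in> {1..T}" for t
  proof -
    obtain r where "t = Suc r" using t by (cases t) auto
    then have "stored T f t = stored T f (t - 1) + s 0 t"
      using t stored[of t] stored[of r] by simp
    then show ?thesis by linarith
  qed
  then have "feasible_flow (game_graph (one_site_game T d \<beta>))
      (capacity (one_site_game T d \<beta>) s) Source Target f"
    using strat sup dem
    unfolding feasible_flow_one_site_game f_simps by (auto simp: is_strategy_def)
  then show ?thesis
    by (auto simp: flow_value_one_site_game f_simps)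
qed

text \<open>A squeeze: \<open>matched_flow\<close> bounds the value from below by the total charging
  capacity, while from above all supply that is used must enter the battery. Hence every charging
  term is tight, and the balance of the battery makes the discharging terms tight too.\<close>

lemma matched_max_flow:
  assumes \<beta>: "\<forall>t. 0 \<le> \<beta> t" and matched: "matched_strategy T d \<beta> (s 0)"
    and f: "max_flow (game_graph (one_site_game T d \<beta>))
      (capacity (one_site_game T d \<beta>) s) Source Target f"
  shows "flow_value (game_graph (one_site_game T d \<beta>)) Source f = (\<Sum>t=1..T. max 0 (s 0 t))"
    and "t \<in> {1..T} \<Longrightarrow> f (charge_arc t) = max 0 (s 0 t)"
    and "t \<in> {1..T} \<Longrightarrow> f (discharge_arc t) = max 0 (- s 0 t)"
proof -
  have dem: "\<forall>t\<in>{1..T}. max 0 (- s 0 t) \<le> max 0 (- d t)"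
    and sum0: "(\<Sum>t=1..T. s 0 t) = 0"
    using matched by (auto simp: matched_strategy_def)
  let ?val = "flow_value (game_graph (one_site_game T d \<beta>)) Source"
  have feas: "feasible_flow (game_graph (one_site_game T d \<beta>))
      (capacity (one_site_game T d \<beta>) s) Source Target f"
    using f by (simp add: max_flow_def is_arg_max_def)
  have val: "?val f = (\<Sum>t=1..T. f (supply_arc t))"
    by (rule flow_value_one_site_game)
  have "(\<Sum>t=1..T. max 0 (s 0 t)) \<le> ?val f"
    using matched_flow[where s = s, OF \<beta> matched] f unfolding max_flow_def is_arg_max_linorder by auto
  moreover have src: "f (supply_arc t) \<le> f (charge_arc t)"
    and chg: "f (charge_arc t) \<le> max 0 (s 0 t)"
    and dis: "f (discharge_arc t) \<le> max 0 (- s 0 t)" if "t \<in> {1..T}" for t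
  proof -
    have *: "f (supply_arc t) \<in> {0..max 0 (d t)}" "f (demand_arc t) \<in> {0..max 0 (- d t)}"
      "f (charge_arc t) \<in> {0..max 0 (s 0 t)}" "f (discharge_arc t) \<in> {0..max 0 (- s 0 t)}"
      "f (supply_arc t) + f (discharge_arc t) = f (demand_arc t) + f (charge_arc t)"
      using feas that unfolding feasible_flow_one_site_game by auto
    \<comment> \<open>If \<open>d t > 0\<close>, the demand and discharge arcs carry 0, so supply
      can only be charged; otherwise there is no supply.\<close>
    then show "f (supply_arc t) \<le> f (charge_arc t)"
      using dem that by (cases "d t > 0") (auto simp: max_def split: if_splits)
    show "f (charge_arc t) \<le> max 0 (s 0 t)" "f (discharge_arc t) \<le> max 0 (- s 0 t)"
      using * by auto
  qed
  moreover have "?val f \<le> (\<Sum>t=1..T. f (charge_arc t))"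
    unfolding val by (intro sum_mono src)
  moreover have "(\<Sum>t=1..T. f (charge_arc t)) \<le> (\<Sum>t=1..T. max 0 (s 0 t))"
    by (intro sum_mono chg)
  ultimately have eq: "(\<Sum>t=1..T. f (charge_arc t)) = (\<Sum>t=1..T. max 0 (s 0 t))"
    and "?val f = (\<Sum>t=1..T. max 0 (s 0 t))"
    by linarith+
  then show "?val f = (\<Sum>t=1..T. max 0 (s 0 t))"
    by blast
  show "f (charge_arc t) = max 0 (s 0 t)" if "t \<in> {1..T}"
    using sum_mono_inv[OF eq chg that] by simp
  have "(\<Sum>t=1..T. max 0 (s 0 t)) - (\<Sum>t=1..T. max 0 (- s 0 t)) = (\<Sum>t=1..T. s 0 t)"
    unfolding sum_subtractf[symmetric] by (rule sum.cong) auto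
  then have "(\<Sum>t=1..T. f (discharge_arc t)) = (\<Sum>t=1..T. max 0 (- s 0 t))"
    using eq total_charge_eq_total_discharge[OF feas] sum0 by simp
  then show "f (discharge_arc t) = max 0 (- s 0 t)" if "t \<in> {1..T}"
    using sum_mono_inv[OF _ dis that] by simp
qed

lemma matched_admissible:
  assumes "\<forall>t. 0 \<le> \<beta> t" "matched_strategy T d \<beta> (s 0)"
  shows "admissible_strategy (one_site_game T d \<beta>) s 0"
  using matched_max_flow(2,3)[where s = s, OF assms]
  by (simp add: admissible_strategy_def admissible_edge_def)

lemma matched_welfare:
  assumes "\<forall>t. 0 \<le> \<beta> t" "matched_strategy T d \<beta> (s 0)"
  shows "welfare (one_site_game T d \<beta>) s = (\<Sum>t=1..T. max 0 (s 0 t))"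
proof -
  obtain f where f: "max_flow (game_graph (one_site_game T d \<beta>))
      (capacity (one_site_game T d \<beta>) s) Source Target f"
    using max_flow_one_site_game_exists[OF assms(1)] by blast
  then show ?thesis
    using matched_max_flow(1)[where s = s, OF assms f] welfare_eq_flow_value[OF f] by simp
qed

text \<open>Abel summation: each storage level is weighted with the next price increment. The
  boundary term vanishes once the strategy sums to 0.\<close>

lemma profit_by_parts:
  fixes \<sigma> p :: "nat \<Rightarrow> real"
  shows "- (\<Sum>t=1..T. \<sigma> t * p t) =
    (\<Sum>t=1..<T. (\<Sum>z=1..t. \<sigma> z) * (p (t + 1) - p t)) - (\<Sum>t=1..T. \<sigma> t) * p T"
proof (induction T)
  case (Suc T)
  then show ?case
    by (cases "T = 0") (auto simp: algebra_simps)
qed simp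

section \<open>Equilibria under ascending prices\<close>

lemma utility_admissible:
  assumes "\<forall>t. 0 \<le> \<beta> t" "admissible_strategy (one_site_game T d \<beta>) s 0"
  shows "utility (one_site_game T d \<beta>) s p 0 =
    ereal (\<Sum>t=1..<T. (\<Sum>z=1..t. s 0 z) * (p (t + 1) - p t))"
  using assms(2) admissible_imp_sum_eq_0[OF assms] profit_by_parts[of "s 0" p T]
  by (simp add: utility_def)

text \<open>Ascending prices make all weights positive, so each storage level contributes most at
  its capacity.\<close>

lemma utility_le_full_battery:
  assumes \<beta>: "\<forall>t. 0 \<le> \<beta> t" and p: "p \<in> ASC T"
    and strat: "is_strategy (one_site_game T d \<beta>) 0 (s 0)"
  shows "utility (one_site_game T d \<beta>) s p 0 \<le> ereal (\<Sum>t=1..<T. \<beta> t * (p (t + 1) - p t))"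
proof (cases "admissible_strategy (one_site_game T d \<beta>) s 0")
  case True
  have "p t < p (t + 1)" if "t \<in> {1..<T}" for t
    using p that by (auto simp: ASC_def strict_mono_on_def)
  then show ?thesis
    using strat unfolding utility_admissible[OF \<beta> True] ereal_less_eq is_strategy_def
    by (force intro!: sum_mono mult_right_mono)
qed (simp add: utility_def)

text \<open>Being matched makes \<open>h\<close> admissible, and being full makes it attain the
  bound of \<open>utility_le_full_battery\<close>.\<close>

lemma full_battery_nash_equilibrium:
  assumes \<beta>: "\<forall>t. 0 \<le> \<beta> t" and p: "p \<in> ASC T" and h: "matched_strategy T d \<beta> h"
    and full: "\<forall>t\<in>{1..<T}. (\<Sum>z=1..t. h z) = \<beta> t"
  shows "nash_equilibrium (one_site_game T d \<beta>) p (\<lambda>b. h)"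
proof -
  have "utility (one_site_game T d \<beta>) (\<lambda>b. h) p 0 = ereal (\<Sum>t=1..<T. \<beta> t * (p (t + 1) - p t))"
    using matched_admissible[where s = "\<lambda>b. h", OF \<beta> h] full
    by (subst utility_admissible[OF \<beta>]) auto
  then show ?thesis
    using utility_le_full_battery[OF \<beta> p] h
    by (auto simp: nash_equilibrium_def is_profile_def matched_strategy_def not_less)
qed

text \<open>Deviating to \<open>h\<close> would earn the upper bound, so an equilibrium earns it as
  well. As the price increments are strictly positive, this forces every storage level to its
  capacity.\<close>

lemma nash_equilibrium_full_battery:
  assumes \<beta>: "\<forall>t. 0 \<le> \<beta> t" and p: "p \<in> ASC T" and h: "matched_strategy T d \<beta> h"
    and full: "\<forall>t\<in>{1..<T}. (\<Sum>z=1..t. h z) = \<beta> t"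
    and nash: "nash_equilibrium (one_site_game T d \<beta>) p s" and "t \<in> {1..T}"
  shows "s 0 t = h t"
proof -
  let ?I = "one_site_game T d \<beta>"
  have strat: "is_strategy ?I 0 (s 0)"
    using nash by (simp add: nash_equilibrium_def is_profile_def)
  have "utility ?I (s(0 := h)) p 0 = ereal (\<Sum>t=1..<T. \<beta> t * (p (t + 1) - p t))"
    using matched_admissible[where s = "s(0 := h)", OF \<beta>] h full
    by (subst utility_admissible[OF \<beta>]) auto
  moreover have "utility ?I (s(0 := h)) p 0 \<le> utility ?I s p 0"
    using nash h by (auto simp: nash_equilibrium_def matched_strategy_def not_less)
  ultimately have ge: "ereal (\<Sum>t=1..<T. \<beta> t * (p (t + 1) - p t)) \<le> utility ?I s p 0"
    by simp
  \<comment> \<open>The lower bound is finite, which excludes the penalty for inadmissible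
    strategies.\<close>
  then have adm: "admissible_strategy ?I s 0"
    by (auto simp: utility_def split: if_splits)
  have inc: "p t < p (t + 1)" if "t \<in> {1..<T}" for t
    using p that by (auto simp: ASC_def strict_mono_on_def)
  have le: "(\<Sum>z=1..t. s 0 z) * (p (t + 1) - p t) \<le> \<beta> t * (p (t + 1) - p t)"
    if "t \<in> {1..<T}" for t
    using strat that inc[OF that] by (intro mult_right_mono) (auto simp: is_strategy_def)
  have "(\<Sum>t=1..<T. (\<Sum>z=1..t. s 0 z) * (p (t + 1) - p t)) =
      (\<Sum>t=1..<T. \<beta> t * (p (t + 1) - p t))"
    using ge unfolding utility_admissible[OF \<beta> adm] ereal_less_eq
    by (intro order.antisym[OF sum_mono[OF le]])
  then have "(\<Sum>z=1..t. s 0 z) * (p (t + 1) - p t) = \<beta> t * (p (t + 1) - p t)"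
    if "t \<in> {1..<T}" for t
    using sum_mono_inv[OF _ le that] by simp
  then have "(\<Sum>z=1..t. s 0 z) = (\<Sum>z=1..t. h z)" if "t \<in> {1..<T}" for t
    using inc[OF that] full that by fastforce
  \<comment> \<open>Prices fix only the levels before \<open>T\<close>; the one at \<open>T\<close>
    comes from admissibility. Differences of consecutive levels then recover the strategy.\<close>
  moreover have "(\<Sum>z=1..T. s 0 z) = (\<Sum>z=1..T. h z)"
    using admissible_imp_sum_eq_0[OF \<beta> adm] h by (simp add: matched_strategy_def)
  ultimately have eq: "(\<Sum>z=1..t. s 0 z) = (\<Sum>z=1..t. h z)" if "t \<le> T" for t
    using that by (cases "t = 0 \<or> t = T") auto
  obtain r where "t = Suc r"
    using \<open>t \<in> {1..T}\<close> by (cases t) auto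
  then show ?thesis
    using eq[of t] eq[of r] \<open>t \<in> {1..T}\<close> by simp
qed

text \<open>Used as a strategy, \<open>d\<close> stores all supply, so it attains the cut bound and
  is optimal. Every equilibrium agrees with \<open>h\<close> on the time range and has its
  welfare.\<close>

lemma welfare_ratio_full_battery:
  assumes \<beta>: "\<forall>t. 0 \<le> \<beta> t" and p: "p \<in> ASC T" and h: "matched_strategy T d \<beta> h"
    and full: "\<forall>t\<in>{1..<T}. (\<Sum>z=1..t. h z) = \<beta> t" and d: "matched_strategy T d \<beta> d"
    and nash: "nash_equilibrium (one_site_game T d \<beta>) p s"
  shows "welfare_ratio (welfare (one_site_game T d \<beta>) (OPT (one_site_game T d \<beta>)))
      (welfare (one_site_game T d \<beta>) s) =
    welfare_ratio (\<Sum>t=1..T. max 0 (d t)) (\<Sum>t=1..T. max 0 (h t))"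
proof -
  let ?I = "one_site_game T d \<beta>"
  have d_welfare: "welfare ?I (\<lambda>b. d) = (\<Sum>t=1..T. max 0 (d t))"
    using matched_welfare[where s = "\<lambda>b. d", OF \<beta> d] .
  have le_d: "welfare ?I s \<le> welfare ?I (\<lambda>b. d)" for s
    unfolding d_welfare by (rule welfare_le_total_supply[OF \<beta>])
  then have "is_arg_max (welfare ?I) (is_profile ?I) (\<lambda>b. d)"
    using d by (simp add: is_arg_max_linorder is_profile_def matched_strategy_def)
  \<comment> \<open>\<open>OPT\<close> is a mere choice term; it is a maximizer because one has just
    been exhibited.\<close>
  then have "is_arg_max (welfare ?I) (is_profile ?I) (OPT ?I)"
    unfolding OPT_def arg_max_def by (rule someI[of "is_arg_max _ _"])
  then have "welfare ?I (OPT ?I) = welfare ?I (\<lambda>b. d)"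
    using d le_d
    by (auto simp: is_arg_max_linorder is_profile_def matched_strategy_def intro!: order.antisym)
  moreover have s_eq: "\<forall>t\<in>{1..T}. s 0 t = h t"
    using nash_equilibrium_full_battery[OF \<beta> p h full nash] by blast
  have "matched_strategy T d \<beta> (s 0)"
    using h nash s_eq
    by (auto simp: matched_strategy_def nash_equilibrium_def is_profile_def)
  then have "welfare ?I s = (\<Sum>t=1..T. max 0 (h t))"
    using matched_welfare[where s = s, OF \<beta>] s_eq by simp
  ultimately show ?thesis
    by (simp add: d_welfare)
qed

section \<open>The lower bound\<close>

text \<open>Used both as the net supply of the instance and as its optimal strategy.\<close>

definition alternating :: "nat \<Rightarrow> nat \<Rightarrow> real" where
  "alternating n t = (if t \<in> {1..2 * n} then (if odd t then 1 else - 1) else 0)"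

definition charge_once :: "nat \<Rightarrow> nat \<Rightarrow> real" where
  "charge_once n t = (if t = 1 then 1 else if t = 2 * n then - 1 else 0)"

text \<open>The capacity 0 from \<open>2 * n\<close> on matters for odd \<open>T\<close>: a full
  battery must be empty after the last demand.\<close>

definition unit_battery :: "nat \<Rightarrow> nat \<Rightarrow> real" where
  "unit_battery n t = (if t < 2 * n then 1 else 0)"

lemma sum_alternating:
  "(\<Sum>z=1..t. alternating n z) = (if t \<le> 2 * n \<and> odd t then 1 else 0)"
proof (induction t)
  case (Suc t)
  then show ?case
    by (cases "Suc t \<le> 2 * n"; cases "t = 2 * n") (auto simp: alternating_def)
qed simp

lemma sum_charge_once:
  assumes "n \<ge> 1" "t \<ge> 1"
  shows "(\<Sum>z=1..t. charge_once n z) = unit_battery n t"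
  using assms(2)
proof (induction t rule: dec_induct)
  case (step t)
  then show ?case
    using assms(1) by (auto simp: charge_once_def unit_battery_def)
qed (use assms(1) in \<open>auto simp: charge_once_def unit_battery_def\<close>)

text \<open>Separate \<open>n\<close> and \<open>m\<close> let the induction extend the range of
  summation while the strategy stays fixed.\<close>

lemma sum_charges_alternating:
  "(\<Sum>t=1..2 * n. max 0 (alternating m t)) = real (min n m)"
  by (induction n) (auto simp: alternating_def)

lemma sum_charges_alternating_div_2:
  "(\<Sum>t=1..T. max 0 (alternating (T div 2) t)) = real (T div 2)"
proof (cases "even T")
  case True
  then show ?thesis
    using sum_charges_alternating[of "T div 2" "T div 2"] by simp
next
  case False
  \<comment> \<open>For odd \<open>T\<close> the last time step lies beyond \<open>2 * n\<close> and
    adds nothing.\<close>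
  then obtain n where "T = Suc (2 * n)"
    by (metis oddE Suc_eq_plus1)
  then show ?thesis
    using sum_charges_alternating[of n n] by (simp add: alternating_def)
qed

lemma matched_alternating:
  assumes "2 * n \<le> T"
  shows "matched_strategy T (alternating n) (unit_battery n) (alternating n)"
  \<comment> \<open>The level is 1 only at odd \<open>t <= 2 * n\<close>, hence at
    \<open>t < 2 * n\<close>, where the capacity is still 1.\<close>
  using assms unfolding matched_strategy_def is_strategy_def sum_alternating
  by (auto simp: unit_battery_def le_less)

lemma matched_charge_once:
  assumes "n \<ge> 1" "2 * n \<le> T"
  shows "matched_strategy T (alternating n) (unit_battery n) (charge_once n)"
proof -
  have "(\<Sum>z=1..t. charge_once n z) = unit_battery n t" if "t \<in> {1..T}" for t
    using sum_charge_once assms that by simp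
  then show ?thesis
    using assms unfolding matched_strategy_def is_strategy_def
    by (simp, auto simp: unit_battery_def alternating_def charge_once_def)
qed

theorem theorem6:
  fixes T :: nat
  assumes "T > 2"
  shows "PoS T (ASC T) \<ge> ereal (real_of_int \<lfloor>real T / 2\<rfloor>)"
proof -
  define n where "n = T div 2"
  let ?I = "one_site_game T (alternating n) (unit_battery n)"
  have n: "n \<ge> 1" "2 * n \<le> T"
    using assms by (auto simp: n_def)
  have \<beta>: "\<forall>t. 0 \<le> unit_battery n t"
    by (simp add: unit_battery_def)
  have full: "\<forall>t\<in>{1..<T}. (\<Sum>z=1..t. charge_once n z) = unit_battery n t"
    using sum_charge_once[OF n(1)] by simp
  note h = matched_charge_once[OF n]
  have "(\<Sum>t=1..T. max 0 (charge_once n t)) = (\<Sum>t=1..T. if t = 1 then 1 else 0)"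
    by (rule sum.cong) (auto simp: charge_once_def)
  then have sum_h: "(\<Sum>t=1..T. max 0 (charge_once n t)) = 1"
    using assms by simp
  \<comment> \<open>The supremum in \<open>PoS\<close> admits only instances with an equilibrium for
    some price profile; the prices \<open>p t = t\<close> provide one.\<close>
  have "(\<lambda>t. real t) \<in> ASC T"
    by (simp add: ASC_def strict_mono_on_def)
  then have "\<exists>p\<in>ASC T. \<exists>s. nash_equilibrium ?I p s"
    using full_battery_nash_equilibrium[OF \<beta> _ h full] by blast
  moreover have "real n = real_of_int \<lfloor>real T / 2\<rfloor>"
    using floor_divide_of_nat_eq[of T 2, where ?'a = real] by (simp add: n_def)
  \<comment> \<open>All ascending prices and all their equilibria give the same ratio
    \<open>n / 1\<close>, so both infima are bounded at once.\<close>
  then have "ereal (real_of_int \<lfloor>real T / 2\<rfloor>) \<le> welfare_ratio (welfare ?I (OPT ?I)) (welfare ?I s)"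
    if "p \<in> ASC T" "nash_equilibrium ?I p s" for p s
    unfolding welfare_ratio_full_battery[OF \<beta> that(1) h full matched_alternating[OF n(2)] that(2)]
    using sum_charges_alternating_div_2[of T] sum_h
    by (simp add: n_def welfare_ratio_def)
  ultimately show ?thesis
    unfolding PoS_def
    by (intro SUP_upper2[where i = ?I] INF_greatest) (auto simp: valid_one_site_game \<beta>)
qed

end
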